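(* There is an absolute constant $\gamma>0$ such that for every real $z>0$ and all integers $d,k\ge 1$ there exists a finite point set $X$ in the Euclidean space $\mathbb{R}^d$ such that any $0.01$-coreset for $(k,z)$-clustering over $X$ has size at least $\gamma\cdot k\cdot\min\{2^{z/20},d\}$, i.e. size $\Omega\left(k\cdot\min\{2^{z/20},d\}\right)$.
   Context: $d(x,y)$ is the Euclidean distance on $\mathbb{R}^d$. $\mathcal{C}$ is the collection of all ordered $k$-tuples of points of $\mathbb{R}^d$ (repetitions allowed), called $k$-center sets. For $C\in\mathcal{C}$, $d(x,C)=\min_{c\in C}d(x,c)$, $d^z(x,C)=(d(x,C))^z$, and $\mathrm{cost}_z(X,C)=\sum_{x\in X}d^z(x,C)$. An $\varepsilon$-coreset for $(k,z)$-clustering over $X$ is a finite set $S\subseteq\mathbb{R}^d$ (not necessarily contained in $X$) with weights $w:S\to\mathbb{R}_{\ge 0}$ such that for every $C\in\mathcal{C}$, $(1-\varepsilon)\,\mathrm{cost}_z(X,C)\le\sum_{x\in S}w(x)\,d^z(x,C)\le(1+\varepsilon)\,\mathrm{cost}_z(X,C)$. Its size is $|S|$. *)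

theory Defs
  imports "HOL-Analysis.Analysis"
begin

text \<open>
  The dimension \<open>d\<close> is quantified inside the theorem (below the absolute constant), so it cannot be a
  type.  Points of \<open>R^d\<close> are sequences of coordinates indexed by \<open>0, ..., d - 1\<close> and vanishing from
  index \<open>d\<close> on, i.e. the points of the library's \<^term>\<open>Euclidean_space d\<close>.  The vanishing condition
  makes the representation unique, so that sets of points have the right cardinality.
\<close>

abbreviation Rd :: "nat \<Rightarrow> (nat \<Rightarrow> real) set"
  where "Rd d \<equiv> topspace (Euclidean_space d)"

definition eucl_dist :: "nat \<Rightarrow> (nat \<Rightarrow> real) \<Rightarrow> (nat \<Rightarrow> real) \<Rightarrow> real"
  where "eucl_dist d x y = L2_set (\<lambda>i. x i - y i) {..<d}"

definition center_sets :: "nat \<Rightarrow> nat \<Rightarrow> (nat \<Rightarrow> real) list set"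
  where "center_sets d k = {C. length C = k \<and> set C \<subseteq> Rd d}"

text \<open>Only meaningful for a nonempty list of centers, i.e. for \<open>k \<ge> 1\<close>.\<close>

definition dist_centers :: "nat \<Rightarrow> (nat \<Rightarrow> real) \<Rightarrow> (nat \<Rightarrow> real) list \<Rightarrow> real"
  where "dist_centers d x C = Min ((\<lambda>c. eucl_dist d x c) ` set C)"

text \<open>
  The exponent \<open>z\<close> is real, whence \<open>powr\<close>; its value \<open>0 powr z = 0\<close> at the base \<open>0\<close> is the intended
  one because \<open>z > 0\<close>.
\<close>

definition cost :: "nat \<Rightarrow> real \<Rightarrow> (nat \<Rightarrow> real) set \<Rightarrow> (nat \<Rightarrow> real) list \<Rightarrow> real"
  where "cost d z X C = (\<Sum>x\<in>X. dist_centers d x C powr z)"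

definition weighted_cost ::
    "nat \<Rightarrow> real \<Rightarrow> (nat \<Rightarrow> real) set \<Rightarrow> ((nat \<Rightarrow> real) \<Rightarrow> real) \<Rightarrow> (nat \<Rightarrow> real) list \<Rightarrow> real"
  where "weighted_cost d z S w C = (\<Sum>x\<in>S. w x * dist_centers d x C powr z)"

definition is_coreset ::
    "nat \<Rightarrow> nat \<Rightarrow> real \<Rightarrow> real \<Rightarrow> (nat \<Rightarrow> real) set \<Rightarrow> (nat \<Rightarrow> real) set \<Rightarrow> ((nat \<Rightarrow> real) \<Rightarrow> real) \<Rightarrow> bool"
  where "is_coreset d k z \<epsilon> X S w \<longleftrightarrow>
    finite S \<and> S \<subseteq> Rd d \<and> (\<forall>x\<in>S. 0 \<le> w x) \<and>
    (\<forall>C\<in>center_sets d k.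
       (1 - \<epsilon>) * cost d z X C \<le> weighted_cost d z S w C \<and>
       weighted_cost d z S w C \<le> (1 + \<epsilon>) * cost d z X C)"

end

theory Submission
  imports Defs
begin

text \<open>
  A set \<open>S\<close> of at most \<open>k\<close> points can itself serve as a center set, at weighted cost \<open>0\<close>, so every
  coreset for an input of more than \<open>k\<close> points has more than \<open>k\<close> points.  This settles the case of bounded \<open>z\<close>.

  For large \<open>z\<close>, let \<open>m\<close> be about \<open>min (2 powr (z / 20)) d\<close> and let \<open>X\<close> consist of \<open>k\<close> well separated
  copies of the orthonormal system \<open>e 0, ..., e (m - 1)\<close>.  Moving the center of a copy from its origin
  to \<open>- e i\<close> raises its cost from \<open>m\<close> to at least \<open>2 powr z\<close>.  A point \<open>q\<close> of the coreset sees a comparable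
  increase only if \<open>q\<close> makes a small angle with \<open>e i\<close>, which happens for at most one \<open>i\<close>.  Hence a
  copy with fewer than \<open>m\<close> coreset points nearby has an index \<open>i\<close> that none of them notices.  If at least half
  of the copies are of this kind, moving all their centers simultaneously makes the weighted cost too
  small: the coreset weights are controlled by the cost at the origins of the copies and at a center far away.
\<close>

section \<open>Distances and center sets\<close>

lemma Rd_iff: "x \<in> Rd d \<longleftrightarrow> (\<forall>i\<ge>d. x i = 0)"
  by (simp add: topspace_Euclidean_space)

lemma eucl_dist_nonneg [simp]: "0 \<le> eucl_dist d x y"
  by (simp add: eucl_dist_def)

lemma eucl_dist_commute: "eucl_dist d x y = eucl_dist d y x"
  by (simp add: eucl_dist_def L2_set_def power2_commute)

lemma eucl_dist_triangle: "eucl_dist d x y \<le> eucl_dist d x v + eucl_dist d v y"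
  using L2_set_triangle_ineq[of "\<lambda>i. x i - v i" "\<lambda>i. v i - y i" "{..<d}"]
  by (simp add: eucl_dist_def)

lemma abs_coordinate_le_eucl_dist: "i < d \<Longrightarrow> \<bar>x i - y i\<bar> \<le> eucl_dist d x y"
  using member_le_L2_set[of "{..<d}" i "\<lambda>i. \<bar>x i - y i\<bar>"]
  by (simp add: eucl_dist_def L2_set_def)

lemma eucl_dist_power2: "eucl_dist d x y ^ 2 = (\<Sum>i<d. (x i - y i)^2)"
  by (simp add: eucl_dist_def L2_set_def sum_nonneg)

lemma eucl_dist_pos:
  assumes "x \<in> Rd d" "y \<in> Rd d" "x \<noteq> y"
  shows "0 < eucl_dist d x y"
proof -
  obtain i where i: "x i \<noteq> y i" using assms(3) by blast
  then have "i < d" using assms by (metis Rd_iff not_le)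
  then show ?thesis using abs_coordinate_le_eucl_dist[of i d x y] i by linarith
qed

lemma dist_centers_le: "c \<in> set C \<Longrightarrow> dist_centers d x C \<le> eucl_dist d x c"
  by (simp add: dist_centers_def)

lemma dist_centers_in: "C \<noteq> [] \<Longrightarrow> \<exists>c\<in>set C. dist_centers d x C = eucl_dist d x c"
  using Min_in[of "eucl_dist d x ` set C"] by (simp add: dist_centers_def image_iff)

lemma dist_centers_nonneg: "C \<noteq> [] \<Longrightarrow> 0 \<le> dist_centers d x C"
  by (metis dist_centers_in eucl_dist_nonneg)

lemma le_dist_centers:
  "C \<noteq> [] \<Longrightarrow> (\<And>c. c \<in> set C \<Longrightarrow> b \<le> eucl_dist d x c) \<Longrightarrow> b \<le> dist_centers d x C"
  using dist_centers_in by metis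

lemma cost_le:
  assumes "finite X" "z \<ge> 0" "C \<noteq> []" "\<And>x. x \<in> X \<Longrightarrow> dist_centers d x C \<le> b"
  shows "cost d z X C \<le> real (card X) * b powr z"
  unfolding cost_def using assms(2-4) dist_centers_nonneg[OF assms(3)]
  by (intro sum_bounded_above powr_mono2) auto

section \<open>Coresets have more than \<open>k\<close> points\<close>

text \<open>A center set has exactly \<open>k\<close> entries with repetitions allowed, so a smaller
  set is padded with copies of one of its points.\<close>

lemma exists_list_of_set:
  assumes "finite A" "A \<noteq> {}" "card A \<le> k"
  shows "\<exists>C. length C = k \<and> set C = A"
proof -
  obtain xs where xs: "set xs = A" "distinct xs" using finite_distinct_list[OF assms(1)] by blast
  then have "length xs \<le> k" using assms(3) distinct_card by fastforce
  then show ?thesis using xs assms(2)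
    by (intro exI[of _ "xs @ replicate (k - length xs) (hd xs)"])
       (auto simp: set_replicate_conv_if hd_in_set)
qed

lemma card_coreset_gt:
  assumes core: "is_coreset d k z \<epsilon> X S w"
    and X: "finite X" "X \<subseteq> Rd d" "card X > k" and "\<epsilon> < 1" "k \<ge> 1"
  shows "card S > k"
proof (rule ccontr)
  assume "\<not> card S > k"
  \<comment> \<open>A center set is nonempty, so an empty coreset is replaced by a single
    point.\<close>
  define A where "A = (if S = {} then {\<lambda>_. 0} else S)"
  have S: "finite S" "S \<subseteq> Rd d" using core by (auto simp: is_coreset_def)
  have A: "finite A" "A \<noteq> {}" "card A \<le> k" "S \<subseteq> A" "A \<subseteq> Rd d"
    using S \<open>\<not> card S > k\<close> \<open>k \<ge> 1\<close> by (auto simp: A_def Rd_iff)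
  obtain C where C: "length C = k" "set C = A" using exists_list_of_set[OF A(1-3)] by blast
  have ne: "C \<noteq> []" using C A by auto
  have "dist_centers d x C = 0" if "x \<in> S" for x
    using dist_centers_le[of x C d x] dist_centers_nonneg[OF ne, of d x] that A(4) C
    by (auto simp: eucl_dist_def L2_set_def)
  then have "weighted_cost d z S w C = 0" by (simp add: weighted_cost_def)
  moreover have "C \<in> center_sets d k" using C A by (simp add: center_sets_def)
  ultimately have *: "(1 - \<epsilon>) * cost d z X C \<le> 0" using core by (auto simp: is_coreset_def)
  \<comment> \<open>By cardinality some point of \<open>X\<close> is not a center, and it alone
    makes the true cost positive.\<close>
  have "\<not> X \<subseteq> A" using A(1,3) X(3) card_mono[of A X] by linarith
  then obtain x where x: "x \<in> X" "x \<notin> A" by blast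
  obtain c where c: "c \<in> set C" "dist_centers d x C = eucl_dist d x c"
    using dist_centers_in[OF ne] by blast
  then have "0 < dist_centers d x C" using x C A X eucl_dist_pos[of x d c] by auto
  then have "0 < cost d z X C"
    unfolding cost_def using x X(1) by (intro sum_pos2[of X x]) auto
  then show False using * \<open>\<epsilon> < 1\<close> by (simp add: mult_le_0_iff)
qed

section \<open>Separated copies of an orthonormal system\<close>

text \<open>Origins of distinct copies have distance at least \<open>4\<close>, so a point \<open>e i\<close> of one copy is not closer to
  the centers used for another copy than to its own antipode \<open>- e i\<close>.\<close>

definition base :: "nat \<Rightarrow> nat \<Rightarrow> real"
  where "base a = (\<lambda>j. if j = 0 then 4 * real a else 0)"

definition shift :: "nat \<Rightarrow> nat \<Rightarrow> real \<Rightarrow> nat \<Rightarrow> real"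
  where "shift a i t = (\<lambda>j. base a j + (if j = i then t else 0))"

lemma shift_0 [simp]: "shift a i 0 = base a"
  by (auto simp: shift_def)

lemma shift_in_Rd: "i < d \<Longrightarrow> shift a i t \<in> Rd d"
  by (auto simp: Rd_iff shift_def base_def)

lemma base_in_Rd: "1 \<le> d \<Longrightarrow> base a \<in> Rd d"
  by (auto simp: Rd_iff base_def)

text \<open>Law of cosines for a step of signed length \<open>t\<close> along axis
  \<open>i\<close>.\<close>

lemma eucl_dist_shift_power2:
  assumes "i < d"
  shows "eucl_dist d p (shift a i t) ^ 2 = eucl_dist d p (base a) ^ 2 - 2 * t * (p i - base a i) + t^2"
proof -
  have "eucl_dist d p (shift a i t) ^ 2 = (\<Sum>j<d. (p j - base a j)^2 +
      (if j = i then - 2 * t * (p i - base a i) + t^2 else 0))"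
    unfolding eucl_dist_power2 shift_def
    by (intro sum.cong) (auto simp: power2_eq_square algebra_simps)
  then show ?thesis using assms by (simp add: sum.distrib eucl_dist_power2)
qed

lemma eucl_dist_shift_shift:
  assumes "i < d"
  shows "eucl_dist d (shift a i s) (shift a i t) = \<bar>s - t\<bar>"
proof -
  have "eucl_dist d (shift a i s) (shift a i t) ^ 2 = (\<Sum>j<d. if j = i then (s - t)^2 else 0)"
    unfolding eucl_dist_power2 shift_def by (intro sum.cong) auto
  also have "\<dots> = \<bar>s - t\<bar> ^ 2" using assms by simp
  finally show ?thesis by (metis abs_ge_zero eucl_dist_nonneg power2_eq_iff_nonneg)
qed

lemma eucl_dist_shift_base: "i < d \<Longrightarrow> eucl_dist d (shift a i s) (base a) = \<bar>s\<bar>"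
  using eucl_dist_shift_shift[of i d a s 0] by simp

text \<open>The first coordinates of the origins differ by at least 4, and each shift changes them
  by at most 1.\<close>

lemma eucl_dist_shift_other_ge:
  assumes "a \<noteq> b" "1 \<le> d" "\<bar>s\<bar> \<le> 1" "\<bar>t\<bar> \<le> 1"
  shows "2 \<le> eucl_dist d (shift a i s) (shift b j t)"
proof -
  have "1 \<le> \<bar>real a - real b\<bar>" using assms(1) by linarith
  then have "2 \<le> \<bar>shift a i s 0 - shift b j t 0\<bar>" using assms
    by (auto simp: shift_def base_def)
  then show ?thesis using abs_coordinate_le_eucl_dist[of 0 d "shift a i s" "shift b j t"] assms(2)
    by linarith
qed

text \<open>A point makes an angle of less than \<open>arccos (3/4)\<close> with at most one of two orthogonal directions,
  as \<open>arccos (3/4) < \<pi>/4\<close>.\<close>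

definition aligned :: "nat \<Rightarrow> nat \<Rightarrow> (nat \<Rightarrow> real) \<Rightarrow> nat \<Rightarrow> bool"
  where "aligned d a p i \<longleftrightarrow> 3/4 * eucl_dist d p (base a) < p i - base a i"

text \<open>Two such coordinates would have squares summing to more than 9/8 of the squared
  distance.\<close>

lemma aligned_unique:
  assumes "aligned d a p i" "aligned d a p j" "i < d" "j < d"
  shows "i = j"
proof (rule ccontr)
  assume "i \<noteq> j"
  define r where "r = eucl_dist d p (base a)"
  define x where "x = p i - base a i"
  define y where "y = p j - base a j"
  have "(\<Sum>l\<in>{i, j}. (p l - base a l)^2) \<le> r^2"
    unfolding r_def eucl_dist_power2 using assms by (intro sum_mono2) auto
  then have le: "x^2 + y^2 \<le> r^2" using \<open>i \<noteq> j\<close> by (simp add: x_def y_def)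
  have r: "0 \<le> r" "3/4 * r < x" "3/4 * r < y" using assms by (auto simp: r_def x_def y_def aligned_def)
  then have "(3/4 * r)^2 < x^2" "(3/4 * r)^2 < y^2" by (auto intro!: power_strict_mono)
  then have "9 * r^2 < 16 * x^2" "9 * r^2 < 16 * y^2"
    by (simp_all add: power_mult_distrib power2_eq_square)
  then show False using le zero_le_power2[of r] by linarith
qed

text \<open>The law of cosines bounds the squared distance by \<open>r^2 + 3/2 * r + 1\<close>,
  whence 7/2. What counts is that \<open>sqrt (7/2) < 2\<close>, as 2 is the distance from
  \<open>e i\<close> to its antipode.\<close>

lemma eucl_dist_not_aligned:
  assumes "\<not> aligned d a p i" "i < d"
  shows "eucl_dist d p (shift a i (-1)) \<le> sqrt (7/2) * max 1 (eucl_dist d p (base a))"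
proof -
  define r where "r = eucl_dist d p (base a)"
  define s where "s = max 1 r"
  have r: "0 \<le> r" "r \<le> s" "1 \<le> s" by (auto simp: r_def s_def)
  have "eucl_dist d p (shift a i (-1)) ^ 2 \<le> r^2 + 3/2 * r + 1"
    using assms by (simp add: eucl_dist_shift_power2 aligned_def r_def)
  moreover have "r^2 \<le> s^2" "r \<le> s^2" "1 \<le> s^2"
    using r mult_mono[of r s 1 s] mult_mono[of r s r s] mult_mono[of 1 s 1 s]
    by (auto simp: power2_eq_square)
  ultimately have "eucl_dist d p (shift a i (-1)) ^ 2 \<le> (sqrt (7/2) * s)^2"
    by (simp add: power_mult_distrib)
  moreover have "0 \<le> sqrt (7/2) * s" using r by (intro mult_nonneg_nonneg) simp_all
  ultimately have "eucl_dist d p (shift a i (-1)) \<le> sqrt (7/2) * s" by (rule power2_le_imp_le)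
  then show ?thesis unfolding s_def r_def .
qed

text \<open>For a center this far away, points at distances between \<open>L - R\<close> and
  \<open>L + R\<close> have costs within a factor of 2, so its cost measures total weight.\<close>

lemma exists_far_radius:
  fixes R z :: real
  assumes "R > 0" "z > 0"
  shows "\<exists>L>R. (L + R) powr z = 2 * (L - R) powr z"
proof -
  \<comment> \<open>\<open>\<rho>\<close> is the ratio of \<open>L + R\<close> to
    \<open>L - R\<close> that the exponent \<open>z\<close> turns into 2.\<close>
  define \<rho> :: real where "\<rho> = 2 powr (1/z)"
  have \<rho>: "\<rho> > 1" using assms powr_less_mono[of 0 "1/z" 2] by (simp add: \<rho>_def)
  define L where "L = R * (\<rho> + 1) / (\<rho> - 1)"
  have L: "L - R = 2 * R / (\<rho> - 1)" "L + R = \<rho> * (2 * R / (\<rho> - 1))"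
    using \<rho> by (auto simp: L_def field_simps)
  have "L > R" using L(1) \<rho> assms
    by (metis diff_gt_0_iff_gt divide_pos_pos mult_pos_pos zero_less_numeral)
  moreover have "\<rho> powr z = 2" using assms by (simp add: \<rho>_def powr_powr)
  ultimately show ?thesis using L \<rho> assms
    by (intro exI[of _ L]) (simp add: powr_mult del: times_divide_eq_right)
qed

text \<open>Since \<open>2 * (7/2)^6 < 2^12\<close>, the base \<open>sqrt (7/2)\<close> is below 2
  by a factor of at least \<open>2 powr (1/12)\<close>. From \<open>z = 120\<close> on, the surplus
  \<open>z/12 - z/20\<close> is at least 4, and \<open>2^4\<close> absorbs the 9.\<close>

lemma powr_gap:
  fixes z m :: real
  assumes "z \<ge> 120" "m \<le> 2 powr (z/20)"
  shows "9 * m * sqrt (7/2) powr z < 2 powr z"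
proof -
  have "(sqrt (7/2) ^ 12 :: real) = (sqrt (7/2) ^ 2) ^ 6" by (subst power_mult [symmetric]) simp
  also have "\<dots> = (7/2) ^ 6" by simp
  finally have "(sqrt (7/2) ^ 12 :: real) = (7/2) ^ 6" .
  then have "(sqrt (7/2) * 2 powr (1/12)) ^ 12 \<le> (2 :: real) ^ 12"
    by (simp add: power_mult_distrib powr_power power_divide)
  then have "sqrt (7/2) * 2 powr (1/12) \<le> (2 :: real)"
    using power_mono_iff[of "sqrt (7/2) * 2 powr (1/12)" "2 :: real" 12] by simp
  then have "(sqrt (7/2) * 2 powr (1/12)) powr z \<le> (2 :: real) powr z"
    using assms by (intro powr_mono2) auto
  then have le: "2 powr (z/12) * sqrt (7/2) powr z \<le> 2 powr z"
    by (simp add: powr_mult powr_powr mult.commute)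
  have "9 * m < 16 * 2 powr (z/20)" using assms(2) powr_gt_zero[of 2 "z/20"] by linarith
  also have "\<dots> = 2 powr (4 + z/20)" by (simp add: powr_add)
  also have "\<dots> \<le> 2 powr (z/12)" using assms by (intro powr_mono) auto
  finally have "9 * m * sqrt (7/2) powr z < 2 powr (z/12) * sqrt (7/2) powr z"
    by (intro mult_strict_right_mono) auto
  then show ?thesis using le by linarith
qed

section \<open>The lower bound\<close>

lemma card_coreset_copies_ge:
  assumes z: "z \<ge> 120" and m: "1 \<le> m" "m \<le> d" "real m \<le> 2 powr (z/20)" and k: "1 \<le> k"
    and core: "is_coreset d k z 0.01 ((\<lambda>(a, i). shift a i 1) ` ({..<k} \<times> {..<m})) S w"
      (is "is_coreset d k z 0.01 ?X S w")
  shows "real k * real m \<le> 2 * real (card S)"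
proof (rule ccontr)
  assume small: "\<not> real k * real m \<le> 2 * real (card S)"
  have d: "1 \<le> d" using m by simp
  have z0: "0 \<le> z" "0 < z" using z by auto
  have S: "finite S" "\<And>p. p \<in> S \<Longrightarrow> 0 \<le> w p" using core by (auto simp: is_coreset_def)
  have coreD: "99/100 * cost d z ?X C \<le> weighted_cost d z S w C"
    "weighted_cost d z S w C \<le> 101/100 * cost d z ?X C" if "C \<in> center_sets d k" for C
    using core that by (auto simp: is_coreset_def power2_eq_square)
  have finX: "finite ?X" by simp
  have cardX: "real (card ?X) \<le> real k * real m"
    using card_image_le[of "{..<k} \<times> {..<m}" "\<lambda>(a, i). shift a i 1"]
    by (simp add: card_cartesian_product flip: of_nat_mult)
  \<comment> \<open>Assigning each point to a nearest origin \<open>n p\<close> splits the coreset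
    among the copies.\<close>
  have "\<exists>a<k. \<forall>b<k. eucl_dist d p (base a) \<le> eucl_dist d p (base b)" for p
  proof -
    let ?D = "(\<lambda>a. eucl_dist d p (base a)) ` {..<k}"
    have "Min ?D \<in> ?D" using k by (intro Min_in) (auto simp: lessThan_empty_iff)
    then obtain a where "a < k" "Min ?D = eucl_dist d p (base a)" by auto
    then show ?thesis by (metis Min_le finite_imageI finite_lessThan imageI lessThan_iff)
  qed
  then obtain n where n: "\<And>p. n p < k"
    "\<And>p b. b < k \<Longrightarrow> eucl_dist d p (base (n p)) \<le> eucl_dist d p (base b)" by metis
  define r where "r p = eucl_dist d p (base (n p))" for p
  have r0: "0 \<le> r p" for p by (simp add: r_def)
  define K where "K = real k * real m"

  \<comment> \<open>Weight bounds from two test center sets\<close>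
  define C0 where "C0 = map base [0..<k]"
  have C0: "C0 \<in> center_sets d k" "C0 \<noteq> []" using base_in_Rd[OF d] k
    by (auto simp: C0_def center_sets_def)
  have "cost d z ?X C0 \<le> real (card ?X) * 1 powr z"
  proof (rule cost_le[OF finX z0(1) C0(2)])
    fix x assume "x \<in> ?X"
    then obtain a i where ai: "a < k" "i < m" "x = shift a i 1" by auto
    then show "dist_centers d x C0 \<le> 1"
      using dist_centers_le[of "base a" C0 d x] eucl_dist_shift_base[of i d a 1] m by (auto simp: C0_def)
  qed
  then have "cost d z ?X C0 \<le> K" using cardX by (simp add: K_def)
  moreover have "(\<Sum>p\<in>S. w p * r p powr z) \<le> weighted_cost d z S w C0"
    unfolding weighted_cost_def
  proof (intro sum_mono mult_left_mono powr_mono2 S(2))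
    fix p show "r p \<le> dist_centers d p C0"
      using C0(2) n(2) by (intro le_dist_centers) (auto simp: C0_def r_def)
  qed (use z0 r0 in auto)
  ultimately have H0: "(\<Sum>p\<in>S. w p * r p powr z) \<le> 101/100 * K" using coreD(2)[OF C0(1)] by linarith

  \<comment> \<open>\<open>H0\<close> says little about weight close to an origin, where
    \<open>r p\<close> is small. A far center on the negative first axis measures it;
    \<open>R\<close> is such that its distances to \<open>?X\<close> and \<open>N\<close> lie
    between \<open>L - R\<close> and \<open>L + R\<close>.\<close>
  define N where "N = {p\<in>S. r p \<le> 1}"
  define R where "R = 4 * real k + 1"
  obtain L where L: "L > R" "(L + R) powr z = 2 * (L - R) powr z"
    using exists_far_radius[of R z] z0 by (auto simp: R_def)
  define far where "far = (\<lambda>j::nat. if j = 0 then - L else 0)"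
  define C1 where "C1 = replicate k far"
  have C1: "C1 \<in> center_sets d k" "C1 \<noteq> []" "set C1 = {far}" using d k
    by (auto simp: C1_def center_sets_def Rd_iff far_def)
  have base_far: "eucl_dist d (base a) far = 4 * real a + L" for a
  proof -
    have "eucl_dist d (base a) far ^ 2 = (\<Sum>j<d. if j = 0 then (4 * real a + L)^2 else 0)"
      unfolding eucl_dist_power2 by (intro sum.cong) (auto simp: base_def far_def)
    also have "\<dots> = (4 * real a + L)^2" using d by simp
    finally show ?thesis using L(1) by (subst (asm) power2_eq_iff_nonneg) (auto simp: R_def)
  qed
  have "cost d z ?X C1 \<le> real (card ?X) * (L + R) powr z"
  proof (rule cost_le[OF finX z0(1) C1(2)])
    fix x assume "x \<in> ?X"
    then obtain a i where ai: "a < k" "i < m" "x = shift a i 1" by auto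
    then have "eucl_dist d x (base a) = 1" using eucl_dist_shift_base[of i d a 1] m by auto
    then show "dist_centers d x C1 \<le> L + R"
      using dist_centers_le[of far C1 d x] eucl_dist_triangle[of d x far "base a"] base_far[of a] ai C1
      by (auto simp: R_def)
  qed
  also have "\<dots> \<le> K * (L + R) powr z" using cardX by (auto intro!: mult_right_mono simp: K_def)
  finally have "cost d z ?X C1 \<le> 2 * K * (L - R) powr z" using L by simp
  moreover have "(\<Sum>p\<in>N. w p * (L - R) powr z) \<le> weighted_cost d z S w C1"
  proof -
    have "(\<Sum>p\<in>N. w p * (L - R) powr z) \<le> (\<Sum>p\<in>N. w p * dist_centers d p C1 powr z)"
    proof (intro sum_mono mult_left_mono powr_mono2)
      fix p assume p: "p \<in> N"
      then show "0 \<le> w p" using S by (auto simp: N_def)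
      have "L - R \<le> eucl_dist d p far"
        using eucl_dist_triangle[of d "base (n p)" far p] base_far[of "n p"] p
        by (simp add: N_def r_def R_def eucl_dist_commute)
      then show "L - R \<le> dist_centers d p C1" using C1 by (intro le_dist_centers) auto
    qed (use z0 L in auto)
    also have "\<dots> \<le> weighted_cost d z S w C1"
      unfolding weighted_cost_def using S by (intro sum_mono2) (auto simp: N_def)
    finally show ?thesis .
  qed
  ultimately have "sum w N * (L - R) powr z \<le> (202/100 * K) * (L - R) powr z"
    using coreD(2)[OF C1(1)] unfolding sum_distrib_right by linarith
  then have H1: "sum w N \<le> 202/100 * K" using L by (simp add: mult_le_cancel_right)

  \<comment> \<open>Copies with a direction that no assigned point notices\<close>
  define T where "T a = {p\<in>S. n p = a}" for a
  define U where "U = {a. a < k \<and> card (T a) < m}"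
  have finU: "finite U" by (simp add: U_def)
  \<comment> \<open>Copies outside \<open>U\<close> use up at least \<open>m\<close> coreset points
    each, so they are fewer than half.\<close>
  have "(\<Sum>a\<in>{..<k} - U. m) \<le> (\<Sum>a\<in>{..<k} - U. card (T a))"
    by (intro sum_mono) (auto simp: U_def)
  also have "\<dots> = card (\<Union>a\<in>{..<k} - U. T a)"
    using S by (intro card_UN_disjoint [symmetric]) (auto simp: T_def)
  also have "\<dots> \<le> card S" using S by (intro card_mono) (auto simp: T_def)
  finally have "(k - card U) * m \<le> card S"
    using finU by (simp add: card_Diff_subset U_def subset_iff)
  moreover have "card U \<le> k" using card_mono[of "{..<k}" U] by (auto simp: U_def)
  ultimately have "(real k - real (card U)) * real m \<le> real (card S)"
    by (metis of_nat_diff of_nat_le_iff of_nat_mult)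
  then have "(2 * (real k - real (card U))) * real m < real k * real m" using small by linarith
  then have cardU: "real k < 2 * real (card U)" using m(1) by (simp add: mult_less_cancel_right)

  \<comment> \<open>Otherwise choosing an aligned point for each direction would inject
    \<open>m\<close> directions into \<open>T a\<close>.\<close>
  have "\<exists>i<m. \<forall>p\<in>T a. \<not> aligned d a p i" if "a \<in> U" for a
  proof (rule ccontr)
    assume "\<not> ?thesis"
    then obtain f where f: "\<And>i. i < m \<Longrightarrow> f i \<in> T a \<and> aligned d a (f i) i" by metis
    have "inj_on f {..<m}"
    proof (rule inj_onI)
      fix i j assume "i \<in> {..<m}" "j \<in> {..<m}" "f i = f j"
      then show "i = j" using aligned_unique[of d a "f i" i j] f[of i] f[of j] m(2) by simp
    qed
    moreover have "f ` {..<m} \<subseteq> T a" using f by auto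
    moreover have "finite (T a)" using S by (simp add: T_def)
    ultimately have "m \<le> card (T a)" using card_inj_on_le[of f "{..<m}" "T a"] by simp
    then show False using that by (simp add: U_def)
  qed
  then obtain h where h: "\<And>a. a \<in> U \<Longrightarrow> h a < m"
    "\<And>a p. a \<in> U \<Longrightarrow> p \<in> T a \<Longrightarrow> \<not> aligned d a p (h a)" by metis

  \<comment> \<open>Moving the centers of all copies in \<open>U\<close> at once\<close>
  define t where "t a = (if a \<in> U then -1 else 0 :: real)" for a
  define i where "i a = (if a \<in> U then h a else 0)" for a
  have i: "i a < m" "i a < d" for a using h(1)[of a] m by (auto simp: i_def)
  define c where "c a = shift a (i a) (t a)" for a
  define C where "C = map c [0..<k]"
  have "c a \<in> Rd d" for a using shift_in_Rd[OF i(2)] by (simp add: c_def)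
  then have C: "C \<in> center_sets d k" "C \<noteq> []" using k
    by (auto simp: C_def center_sets_def)
  define g where "g = sqrt (7/2 :: real)"
  have g: "1 \<le> g" by (simp add: g_def)

  have "weighted_cost d z S w C \<le> (\<Sum>p\<in>S. g powr z * ((if r p \<le> 1 then w p else 0) + w p * r p powr z))"
    unfolding weighted_cost_def
  proof (intro sum_mono)
    fix p assume p: "p \<in> S"
    \<comment> \<open>The center of the assigned copy suffices: if it moved, \<open>p\<close> is not
      aligned with the chosen direction.\<close>
    have "eucl_dist d p (c (n p)) \<le> g * max 1 (r p)" if "n p \<in> U"
      using eucl_dist_not_aligned[of d "n p" p "h (n p)"] h[OF that] p m that
      by (simp add: c_def i_def t_def r_def g_def T_def)
    moreover have "eucl_dist d p (c (n p)) \<le> g * r p" if "n p \<notin> U"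
      using that mult_right_mono[OF g r0[of p]] by (simp add: c_def t_def r_def)
    moreover have "dist_centers d p C \<le> eucl_dist d p (c (n p))"
      using n(1)[of p] by (intro dist_centers_le) (auto simp: C_def)
    moreover have "g * r p \<le> g * max 1 (r p)" using g by (intro mult_left_mono) auto
    ultimately have "dist_centers d p C \<le> g * max 1 (r p)" by linarith
    then have "dist_centers d p C powr z \<le> (g * max 1 (r p)) powr z"
      using z0 dist_centers_nonneg[OF C(2)] by (intro powr_mono2) auto
    also have "\<dots> = g powr z * max 1 (r p) powr z" using g by (simp add: powr_mult)
    \<comment> \<open>The indicator accounts for \<open>N\<close>, whose weight \<open>H1\<close>
      bounds; the power is summed by \<open>H0\<close>.\<close>
    also have "\<dots> \<le> g powr z * ((if r p \<le> 1 then 1 else 0) + r p powr z)"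
      by (intro mult_left_mono) (auto simp: max_def)
    finally have "w p * dist_centers d p C powr z \<le>
        w p * (g powr z * ((if r p \<le> 1 then 1 else 0) + r p powr z))"
      using S(2)[OF p] by (intro mult_left_mono)
    then show "w p * dist_centers d p C powr z \<le>
        g powr z * ((if r p \<le> 1 then w p else 0) + w p * r p powr z)"
      by (auto simp: algebra_simps)
  qed
  also have "\<dots> = g powr z * (sum w N + (\<Sum>p\<in>S. w p * r p powr z))"
    using S(1) by (simp add: N_def sum.inter_filter sum.distrib flip: sum_distrib_left)
  also have "\<dots> \<le> g powr z * (303/100 * K)" using H0 H1 by (intro mult_left_mono) auto
  finally have upper: "weighted_cost d z S w C \<le> g powr z * (303/100 * K)" .

  \<comment> \<open>One witness per copy in \<open>U\<close>: the point opposite the moved center is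
    at distance 2 from it and at least 2 from all other centers.\<close>
  define x where "x a = shift a (i a) 1" for a
  have "x a \<noteq> x b" if "a \<noteq> b" for a b
    using eucl_dist_shift_other_ge[OF that d, of 1 1 "i a" "i b"]
    by (auto simp: x_def eucl_dist_def L2_set_def)
  then have inj: "inj_on x U" by (auto simp: inj_on_def)
  have "real (card U) * 2 powr z \<le> (\<Sum>a\<in>U. dist_centers d (x a) C powr z)"
  proof (intro sum_bounded_below powr_mono2)
    fix a assume a: "a \<in> U"
    show "2 \<le> dist_centers d (x a) C"
    proof (rule le_dist_centers[OF C(2)])
      fix y assume "y \<in> set C"
      then obtain b where y: "y = c b" by (auto simp: C_def)
      show "2 \<le> eucl_dist d (x a) y"
        using eucl_dist_shift_other_ge[of a b d 1 "t b" "i a" "i b"] d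
          eucl_dist_shift_shift[of "i a" d a 1 "-1"] i[of a] a
        by (cases "a = b") (auto simp: x_def y c_def t_def)
    qed
  qed (use z0 in auto)
  also have "\<dots> = (\<Sum>y\<in>x ` U. dist_centers d y C powr z)" using inj by (simp add: sum.reindex)
  also have "\<dots> \<le> cost d z ?X C"
    unfolding cost_def using i by (intro sum_mono2) (auto simp: x_def U_def)
  finally have "99/100 * (real (card U) * 2 powr z) \<le> 303/100 * (g powr z * K)"
    using coreD(1)[OF C(1)] upper by linarith
  \<comment> \<open>With \<open>card U > k / 2\<close>, the cost bounds put
    \<open>k * 2 powr z\<close> at no more than \<open>606/99 * (g powr z * K)\<close>, against the
    factor 9 of the gap.\<close>
  moreover have "real k * 2 powr z \<le> 2 * (real (card U) * 2 powr z)"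
    using mult_right_mono[OF less_imp_le[OF cardU], of "2 powr z"] by simp
  moreover have "9 * (g powr z * K) < real k * 2 powr z"
    using mult_strict_left_mono[OF powr_gap[OF z m(3)], of "real k"] k
    by (simp add: g_def K_def mult_ac)
  moreover have "0 \<le> g powr z * K" by (simp add: K_def)
  ultimately show False by linarith
qed

theorem theorem1p4:
  shows "\<exists>\<gamma>::real. \<gamma> > 0 \<and>
    (\<forall>(z::real) (d::nat) (k::nat). z > 0 \<longrightarrow> d \<ge> 1 \<longrightarrow> k \<ge> 1 \<longrightarrow>
      (\<exists>X. finite X \<and> X \<subseteq> Rd d \<and>
        (\<forall>S w. is_coreset d k z 0.01 X S w \<longrightarrow>
           real (card S) \<ge> \<gamma> * real k * min (2 powr (z / 20)) (real d))))"
proof (intro exI[of _ "1/64"] conjI allI impI)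
  fix z :: real and d k :: nat
  assume zdk: "z > 0" "d \<ge> 1" "k \<ge> 1"
  \<comment> \<open>The constant 1/64 is dictated by \<open>z < 120\<close>, where \<open>M\<close>
    is at most \<open>2^6\<close> and \<open>k + 1\<close> points serve as input.\<close>
  define M where "M = min (2 powr (z / 20)) (real d)"
  show "\<exists>X. finite X \<and> X \<subseteq> Rd d \<and> (\<forall>S w. is_coreset d k z 0.01 X S w \<longrightarrow>
      real (card S) \<ge> 1/64 * real k * M)"
  proof (cases "z \<ge> 120")
    case True
    have M: "1 \<le> M" using zdk by (simp add: M_def ge_one_powr_ge_zero)
    define m where "m = nat \<lfloor>M\<rfloor>"
    have fl: "1 \<le> \<lfloor>M\<rfloor>" using M by simp
    then have "real m = of_int \<lfloor>M\<rfloor>" by (simp add: m_def)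
    then have m: "1 \<le> m" "real m \<le> M" "M \<le> 2 * real m" using fl M by linarith+
    have md: "m \<le> d" "real m \<le> 2 powr (z/20)" using m(2) by (simp_all add: M_def)
    define X where "X = (\<lambda>(a, i). shift a i 1) ` ({..<k} \<times> {..<m})"
    have "real (card S) \<ge> 1/64 * real k * M" if "is_coreset d k z 0.01 X S w" for S w
      using card_coreset_copies_ge[OF True m(1) md zdk(3) that[unfolded X_def]]
        mult_left_mono[OF m(3), of "real k"] by simp
    moreover have "finite X" by (simp add: X_def)
    moreover have "X \<subseteq> Rd d" using md(1) shift_in_Rd unfolding X_def by fastforce
    ultimately show ?thesis by blast
  next
    case False
    then have "2 powr (z/20) \<le> 2 powr (6::real)" by (intro powr_mono) auto
    then have M: "M \<le> 64" by (simp add: M_def)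
    have "inj base" by (auto simp: inj_def base_def fun_eq_iff)
    then have X: "finite (base ` {..k})" "base ` {..k} \<subseteq> Rd d" "card (base ` {..k}) > k"
      using base_in_Rd[OF zdk(2)] by (auto simp: card_image inj_on_subset)
    have "real (card S) \<ge> 1/64 * real k * M" if "is_coreset d k z 0.01 (base ` {..k}) S w" for S w
      using card_coreset_gt[OF that X _ zdk(3)] mult_left_mono[OF M, of "real k"] by simp
    then show ?thesis using X by blast
  qed
qed simp

end
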